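(* Let $\mathcal{E}=\langle\mathcal{T},\mathcal{P},\mathcal{A}\rangle$ be a CQE instance. Then: (i) if $\mathcal{P}$ is a set of denials, then $\mathcal{C}^{\mathcal{E}}_{\mathsf{MPV}}=\mathcal{C}^{\mathcal{E}}_{\mathsf{IGA}}$; (ii) if $\mathcal{T}$ is a $\text{DL-Lite}_{\mathcal{R}}$ TBox and $\mathcal{P}$ is linear, then $\mathcal{C}^{\mathcal{E}}_{\mathsf{MPV}}=\mathcal{C}^{\mathcal{E}}_{\mathsf{IGA}}$.
   Context: Signature: predicates are unary (concept names) or binary (role names); $\Sigma_I$ is a countably infinite set of constants. A fact is a ground atom. An ABox is a set of facts; a TBox of a Description Logic (DL) is a set of axioms of that DL, viewed as first-order (FO) sentences over these predicates. A $\text{DL-Lite}_{\mathcal{R}}$ TBox is a finite set of axioms $C_1\sqsubseteq C_2$, $C_1\sqsubseteq\neg C_2$, $R_1\sqsubseteq R_2$, $R_1\sqsubseteq\neg R_2$, where basic roles $R_i$ are role names $P$ or inverses $P^-$, and basic concepts $C_i$ are concept names or unqualified existentials $\exists R$ ($R$ a basic role), with the standard FO semantics. $\models$ is FO entailment. A conjunctive query (CQ) is $\exists\vec{x}\,\phi$ with $\phi$ a conjunction of atoms (constants allowed); the special ground CQ $\bot$, false in every interpretation, is also allowed. Epistemic dependency (ED): $\tau=\forall\vec{x}_1,\vec{x}_2\,(K q_b(\vec{x}_1,\vec{x}_2)\to K q_h(\vec{x}_2))$, where $q_b,q_h$ are CQs with the displayed free variables; $\mathsf{body}(\tau)=q_b$,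 $\mathsf{head}(\tau)=q_h$. $\tau$ is linear if $q_b$ contains only one atom, and is a denial if $q_h=\bot$. A ground substitution $\sigma$ for $\tau$ maps its universally quantified variables to constants; $\sigma(\tau)$ is the resulting instance, and $\mathit{gs}(\tau)$ is the set of all ground substitutions for $\tau$. An FO theory $\Phi$ satisfies $\tau$ if for every $\sigma\in\mathit{gs}(\tau)$, $\Phi\models\mathsf{body}(\sigma(\tau))$ implies $\Phi\models\mathsf{head}(\sigma(\tau))$. A policy is a finite set of EDs (linear if all its EDs are); $\Phi$ satisfies it if it satisfies all its EDs. A CQE instance is $\mathcal{E}=\langle\mathcal{T},\mathcal{P},\mathcal{A}\rangle$ with $\mathcal{T}$ a DL TBox, $\mathcal{P}$ a policy, $\mathcal{A}$ an ABox, and $\mathcal{T}\cup\mathcal{A}$ consistent. $\mathsf{cl}_{\mathcal{T}}(\mathcal{A})$ is the set of facts $\alpha$ with $\mathcal{T}\cup\mathcal{A}\models\alpha$; it is understood to be finite. A GA censor of $\mathcal{E}$ is a set $\mathcal{C}\subseteq\mathsf{cl}_{\mathcal{T}}(\mathcal{A})$ such that $\mathcal{T}\cup\mathcal{C}$ satisfies $\mathcal{P}$; it is optimal if no proper superset of it is a GA censor of $\mathcal{E}$. $\mathcal{C}^{\mathcal{E}}_{\mathsf{IGA}}$ is the intersection of all optimal GA censors of $\mathcal{E}$. Given $\mathcal{A}'\subseteq\mathsf{cl}_{\mathcal{T}}(\mathcal{A})$, a minimal policy violation (MPV) of $\mathcal{E}$ w.r.t. $\mathcal{A}'$ is a $\subseteq$-minimal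 subset $\mathcal{A}''$ of $\mathsf{cl}_{\mathcal{T}}(\mathcal{A})$ such that there exist $\tau\in\mathcal{P}$ and $\sigma\in\mathit{gs}(\tau)$ such that $\mathcal{T}\cup\mathcal{A}''\models\mathsf{body}(\sigma(\tau))$ and $\mathcal{T}\cup\mathcal{A}'\not\models\mathsf{head}(\sigma(\tau))$ (i.e. $\mathcal{A}''$ is minimal among all sets for which such $\tau,\sigma$ exist). $\mathit{MPV}_0(\mathcal{E},\mathcal{A}')$ is the union of all MPVs of $\mathcal{E}$ w.r.t. $\mathcal{A}'$. $\mathit{MPV}(\mathcal{E},0)=\emptyset$ and, for every integer $i\geq 0$, $\mathit{MPV}(\mathcal{E},i+1)=\mathit{MPV}_0(\mathcal{E},\mathsf{cl}_{\mathcal{T}}(\mathcal{A})\setminus\mathit{MPV}(\mathcal{E},i))$. $\mathit{MPV}(\mathcal{E}):=\mathit{MPV}(\mathcal{E},|\mathsf{cl}_{\mathcal{T}}(\mathcal{A})|)$. The MPV censor of $\mathcal{E}$ is $\mathcal{C}^{\mathcal{E}}_{\mathsf{MPV}}:=\mathsf{cl}_{\mathcal{T}}(\mathcal{A})\setminus\mathit{MPV}(\mathcal{E})$. *)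

theory Defs
  imports Main "HOL-Library.Countable" "HOL-Library.Infinite_Typeclass"
begin

section \<open>First-order logic over unary and binary predicates\<close>

text \<open>
  Type variables: \<open>'p\<close> concept names (unary predicates), \<open>'r\<close> role names (binary predicates),
  \<open>'c\<close> constants, \<open>'d\<close> domain elements. Variables are natural numbers.
\<close>

datatype 'c trm = Var nat | Const 'c

datatype ('p, 'r, 'c) atom = CAtom 'p "'c trm" | RAtom 'r "'c trm" "'c trm"

datatype ('p, 'r, 'c) fm =
    FBot
  | FAtom "('p, 'r, 'c) atom"
  | FEq "'c trm" "'c trm"
  | FNeg "('p, 'r, 'c) fm"
  | FAnd "('p, 'r, 'c) fm" "('p, 'r, 'c) fm"
  | FOr "('p, 'r, 'c) fm" "('p, 'r, 'c) fm"
  | FImp "('p, 'r, 'c) fm" "('p, 'r, 'c) fm"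
  | FEx nat "('p, 'r, 'c) fm"
  | FAll nat "('p, 'r, 'c) fm"

primrec fv_trm :: "'c trm \<Rightarrow> nat set" where
  "fv_trm (Var x) = {x}"
| "fv_trm (Const c) = {}"

primrec fv_atom :: "('p, 'r, 'c) atom \<Rightarrow> nat set" where
  "fv_atom (CAtom p t) = fv_trm t"
| "fv_atom (RAtom r t u) = fv_trm t \<union> fv_trm u"

primrec fv :: "('p, 'r, 'c) fm \<Rightarrow> nat set" where
  "fv FBot = {}"
| "fv (FAtom a) = fv_atom a"
| "fv (FEq t u) = fv_trm t \<union> fv_trm u"
| "fv (FNeg f) = fv f"
| "fv (FAnd f g) = fv f \<union> fv g"
| "fv (FOr f g) = fv f \<union> fv g"
| "fv (FImp f g) = fv f \<union> fv g"
| "fv (FEx x f) = fv f - {x}"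
| "fv (FAll x f) = fv f - {x}"

definition sentence :: "('p, 'r, 'c) fm \<Rightarrow> bool" where
  "sentence f \<longleftrightarrow> fv f = {}"

record ('p, 'r, 'c, 'd) interp =
  universe :: "'d set"
  con :: "'c \<Rightarrow> 'd"
  cext :: "'p \<Rightarrow> 'd set"
  rext :: "'r \<Rightarrow> ('d \<times> 'd) set"

definition wf_interp :: "('p, 'r, 'c, 'd) interp \<Rightarrow> bool" where
  "wf_interp I \<longleftrightarrow> universe I \<noteq> {} \<and> (\<forall>c. con I c \<in> universe I) \<and>
     (\<forall>p. cext I p \<subseteq> universe I) \<and> (\<forall>r. rext I r \<subseteq> universe I \<times> universe I)"

primrec val :: "('p, 'r, 'c, 'd) interp \<Rightarrow> (nat \<Rightarrow> 'd) \<Rightarrow> 'c trm \<Rightarrow> 'd" where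
  "val I e (Var x) = e x"
| "val I e (Const c) = con I c"

primrec sat_atom :: "('p, 'r, 'c, 'd) interp \<Rightarrow> (nat \<Rightarrow> 'd) \<Rightarrow> ('p, 'r, 'c) atom \<Rightarrow> bool" where
  "sat_atom I e (CAtom p t) \<longleftrightarrow> val I e t \<in> cext I p"
| "sat_atom I e (RAtom r t u) \<longleftrightarrow> (val I e t, val I e u) \<in> rext I r"

primrec sat :: "('p, 'r, 'c, 'd) interp \<Rightarrow> (nat \<Rightarrow> 'd) \<Rightarrow> ('p, 'r, 'c) fm \<Rightarrow> bool" where
  "sat I e FBot \<longleftrightarrow> False"
| "sat I e (FAtom a) \<longleftrightarrow> sat_atom I e a"
| "sat I e (FEq t u) \<longleftrightarrow> val I e t = val I e u"
| "sat I e (FNeg f) \<longleftrightarrow> \<not> sat I e f"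
| "sat I e (FAnd f g) \<longleftrightarrow> sat I e f \<and> sat I e g"
| "sat I e (FOr f g) \<longleftrightarrow> sat I e f \<or> sat I e g"
| "sat I e (FImp f g) \<longleftrightarrow> (sat I e f \<longrightarrow> sat I e g)"
| "sat I e (FEx x f) \<longleftrightarrow> (\<exists>d\<in>universe I. sat I (e(x := d)) f)"
| "sat I e (FAll x f) \<longleftrightarrow> (\<forall>d\<in>universe I. sat I (e(x := d)) f)"

definition true_in :: "('p, 'r, 'c, 'd) interp \<Rightarrow> ('p, 'r, 'c) fm \<Rightarrow> bool" where
  "true_in I f \<longleftrightarrow> (\<forall>e. range e \<subseteq> universe I \<longrightarrow> sat I e f)"

definition model_of :: "('p, 'r, 'c, 'd) interp \<Rightarrow> ('p, 'r, 'c) fm set \<Rightarrow> bool" where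
  "model_of I \<Phi> \<longleftrightarrow> wf_interp I \<and> (\<forall>f\<in>\<Phi>. true_in I f)"

text \<open>
  A definition cannot quantify over all types of domain elements, so entailment and consistency
  refer to interpretations whose domain is a nonempty subset of the type \<open>elem\<close>, which is large
  enough for the signature at hand: by the lemmas \<open>entailsD\<close> and \<open>consistentI\<close> below (downward
  Loewenheim-Skolem), for sentences these are the usual notions, with domains of arbitrary type.
\<close>

datatype ('p, 'r, 'c) elem = Wit nat "('p, 'r, 'c) fm" "('p, 'r, 'c) elem list"

definition entails :: "('p, 'r, 'c) fm set \<Rightarrow> ('p, 'r, 'c) fm \<Rightarrow> bool" where
  "entails \<Phi> f \<longleftrightarrow> (\<forall>I :: ('p, 'r, 'c, ('p, 'r, 'c) elem) interp. model_of I \<Phi> \<longrightarrow> true_in I f)"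

definition consistent :: "('p, 'r, 'c) fm set \<Rightarrow> bool" where
  "consistent \<Phi> \<longleftrightarrow> (\<exists>I :: ('p, 'r, 'c, ('p, 'r, 'c) elem) interp. model_of I \<Phi>)"


subsection \<open>Independence of the choice of domain type\<close>

lemma val_cong: "(\<And>x. x \<in> fv_trm t \<Longrightarrow> e x = e' x) \<Longrightarrow> val I e t = val I e' t"
  by (cases t) auto

lemma sat_atom_cong:
  "(\<And>x. x \<in> fv_atom a \<Longrightarrow> e x = e' x) \<Longrightarrow> sat_atom I e a = sat_atom I e' a"
proof (cases a)
  case (CAtom p t)
  then show "(\<And>x. x \<in> fv_atom a \<Longrightarrow> e x = e' x) \<Longrightarrow> ?thesis"
    using val_cong[of t e e' I] by simp
next
  case (RAtom r t u)
  then show "(\<And>x. x \<in> fv_atom a \<Longrightarrow> e x = e' x) \<Longrightarrow> ?thesis"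
    using val_cong[of t e e' I] val_cong[of u e e' I] by simp
qed

lemma sat_cong: "(\<And>x. x \<in> fv f \<Longrightarrow> e x = e' x) \<Longrightarrow> sat I e f = sat I e' f"
proof (induction f arbitrary: e e')
  case (FAtom a)
  then show ?case using sat_atom_cong[of a e e' I] by simp
next
  case (FEq t u)
  then show ?case using val_cong[of t e e' I] val_cong[of u e e' I] by simp
next
  case (FNeg f)
  from FNeg.IH[of e e'] FNeg.prems show ?case by simp
next
  case (FAnd f g)
  from FAnd.IH[of e e'] FAnd.prems show ?case by simp
next
  case (FOr f g)
  from FOr.IH[of e e'] FOr.prems show ?case by simp
next
  case (FImp f g)
  from FImp.IH[of e e'] FImp.prems show ?case by simp
next
  case (FEx x f)
  have "sat I (e(x := d)) f = sat I (e'(x := d)) f" for d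
    by (rule FEx.IH) (use FEx.prems in auto)
  then show ?case by simp
next
  case (FAll x f)
  have "sat I (e(x := d)) f = sat I (e'(x := d)) f" for d
    by (rule FAll.IH) (use FAll.prems in auto)
  then show ?case by simp
qed simp

lemma finite_fv:
  fixes f :: "('p, 'r, 'c) fm"
  shows "finite (fv f)"
proof -
  have trm: "finite (fv_trm t)" for t :: "'c trm" by (cases t) auto
  have atm: "finite (fv_atom a)" for a :: "('p, 'r, 'c) atom" by (cases a) (auto simp: trm)
  show ?thesis by (induction f) (auto simp: trm atm)
qed

lemma true_in_sentence:
  assumes "sentence f" "range e \<subseteq> universe I"
  shows "true_in I f \<longleftrightarrow> sat I e f"
  using assms sat_cong[of f _ e I] unfolding true_in_def sentence_def by blast

text \<open>Tarski-Vaught: \<open>wit I\<close> picks witnesses, \<open>ev I\<close> maps the type \<open>elem\<close> onto their closure.\<close>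

definition wit ::
  "('p, 'r, 'c, 'd) interp \<Rightarrow> nat \<Rightarrow> ('p, 'r, 'c) fm \<Rightarrow> 'd list \<Rightarrow> 'd" where
  "wit I x f ds = (SOME d. d \<in> universe I \<and>
     ((\<exists>d'\<in>universe I. sat I ((\<lambda>i. ds ! i)(x := d')) f) \<longrightarrow> sat I ((\<lambda>i. ds ! i)(x := d)) f))"

primrec ev :: "('p, 'r, 'c, 'd) interp \<Rightarrow> ('p, 'r, 'c) elem \<Rightarrow> 'd" where
  "ev I (Wit x f ts) = wit I x f (map (ev I) ts)"

lemma wit_props:
  assumes "wf_interp I"
  shows "wit I x f ds \<in> universe I"
    and "d' \<in> universe I \<Longrightarrow> sat I ((\<lambda>i. ds ! i)(x := d')) f \<Longrightarrow>
      sat I ((\<lambda>i. ds ! i)(x := wit I x f ds)) f"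
proof -
  let ?P = "\<lambda>d. d \<in> universe I \<and>
     ((\<exists>d'\<in>universe I. sat I ((\<lambda>i. ds ! i)(x := d')) f) \<longrightarrow> sat I ((\<lambda>i. ds ! i)(x := d)) f)"
  have "\<exists>d. ?P d" using assms unfolding wf_interp_def by blast
  then have "?P (wit I x f ds)" unfolding wit_def by (rule someI_ex)
  then show "wit I x f ds \<in> universe I"
    and "d' \<in> universe I \<Longrightarrow> sat I ((\<lambda>i. ds ! i)(x := d')) f \<Longrightarrow>
      sat I ((\<lambda>i. ds ! i)(x := wit I x f ds)) f" by blast+
qed

lemma ev_in_universe: "wf_interp I \<Longrightarrow> ev I t \<in> universe I"
  by (cases t) (simp add: wit_props)

lemma ex_ev_witness:
  assumes wf: "wf_interp I" and e: "range e \<subseteq> range (ev I)"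
    and d: "d \<in> universe I" and sat: "sat I (e(x := d)) f"
  shows "\<exists>t. sat I (e(x := ev I t)) f"
proof -
  obtain n where n: "\<forall>y\<in>fv f. y < n"
    using finite_fv[of f] by (auto simp: finite_nat_set_iff_bounded)
  define s where "s = (\<lambda>i. inv (ev I) (e i))"
  have s: "e i = ev I (s i)" for i
  proof -
    have "e i \<in> range (ev I)" using e by (rule subsetD) (rule rangeI)
    then show ?thesis by (simp add: s_def f_inv_into_f)
  qed
  define ts where "ts = map s [0..<n]"
  have nth: "map (ev I) ts ! i = e i" if "i < n" for i using that by (simp add: ts_def s)
  have cong: "sat I (e(x := a)) f \<longleftrightarrow> sat I ((\<lambda>i. map (ev I) ts ! i)(x := a)) f" for a
    by (rule sat_cong) (use n nth in auto)
  have "sat I ((\<lambda>i. map (ev I) ts ! i)(x := wit I x f (map (ev I) ts))) f"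
    by (rule wit_props(2)[OF wf d]) (use sat cong in simp)
  then have "sat I (e(x := ev I (Wit x f ts))) f" using cong by simp
  then show ?thesis by blast
qed

lemma loewenheim_skolem:
  fixes I :: "('p, 'r, 'c, 'd) interp"
  assumes wf: "wf_interp I"
  shows "\<exists>J :: ('p, 'r, 'c, ('p, 'r, 'c) elem) interp. wf_interp J \<and>
    (\<forall>f. sentence f \<longrightarrow> true_in J f = true_in I f)"
proof -
  define k where "k = inv (ev I)"
  have evk: "ev I (k d) = d" if "d \<in> range (ev I)" for d
    using that by (simp add: k_def f_inv_into_f)
  define D where "D = k ` range (ev I)"
  have con: "con I c \<in> range (ev I)" for c
  proof -
    have "\<exists>t. sat I ((\<lambda>_. ev I undefined)(0 := ev I t)) (FEq (Var 0) (Const c))"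
      by (rule ex_ev_witness[OF wf, of _ "con I c"]) (use wf in \<open>auto simp: wf_interp_def\<close>)
    then obtain t where "ev I t = con I c" by auto
    then show ?thesis by (metis rangeI)
  qed
  define J :: "('p, 'r, 'c, ('p, 'r, 'c) elem) interp" where
    "J = \<lparr>universe = D, con = (\<lambda>c. k (con I c)), cext = (\<lambda>p. {t \<in> D. ev I t \<in> cext I p}),
      rext = (\<lambda>r. {(t, u) \<in> D \<times> D. (ev I t, ev I u) \<in> rext I r})\<rparr>"
  have J: "universe J = D" "con J c = k (con I c)" "cext J p = {t \<in> D. ev I t \<in> cext I p}"
    "rext J r = {(t, u) \<in> D \<times> D. (ev I t, ev I u) \<in> rext I r}" for c p r
    by (simp_all add: J_def)
  have wfJ: "wf_interp J" using con by (auto simp: wf_interp_def J D_def)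
  have kD: "k d \<in> D" if "d \<in> range (ev I)" for d using that by (auto simp: D_def)
  have inj: "ev I t = ev I u \<longleftrightarrow> t = u" if "t \<in> D" "u \<in> D" for t u
    using that evk by (auto simp: D_def)
  have valD: "val J e t \<in> D" if "range e \<subseteq> D" for e t
    using that con kD by (cases t) (auto simp: J)
  have val: "ev I (val J e t) = val I (\<lambda>x. ev I (e x)) t" if "range e \<subseteq> D" for e t
    using that evk con by (cases t) (auto simp: J)
  have main: "sat J e f \<longleftrightarrow> sat I (\<lambda>x. ev I (e x)) f" if "range e \<subseteq> D" for e f
    using that
  proof (induction f arbitrary: e)
    case (FAtom a)
    then show ?case by (cases a) (use val valD in \<open>auto simp: J\<close>)
  next
    case (FEq t u)
    then show ?case using inj[OF valD valD, of e e t u] val by simp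
  next
    case (FEx x f)
    have upd: "sat J (e(x := t)) f \<longleftrightarrow> sat I ((\<lambda>y. ev I (e y))(x := ev I t)) f" if "t \<in> D" for t
    proof -
      have "range (e(x := t)) \<subseteq> D" using that FEx.prems by auto
      moreover have "(\<lambda>y. ev I ((e(x := t)) y)) = (\<lambda>y. ev I (e y))(x := ev I t)" by auto
      ultimately show ?thesis using FEx.IH by metis
    qed
    have "(\<exists>d\<in>universe I. sat I ((\<lambda>y. ev I (e y))(x := d)) f) \<longleftrightarrow>
      (\<exists>t\<in>D. sat I ((\<lambda>y. ev I (e y))(x := ev I t)) f)" (is "?L \<longleftrightarrow> ?R")
    proof
      assume ?L
      then obtain t where "sat I ((\<lambda>y. ev I (e y))(x := ev I t)) f"
        using ex_ev_witness[OF wf, of "\<lambda>y. ev I (e y)"] by blast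
      then show ?R using evk[of "ev I t"] kD[of "ev I t"] by (metis rangeI)
    next
      assume ?R
      then show ?L using ev_in_universe[OF wf] by blast
    qed
    then show ?case using upd by (simp add: J)
  next
    case (FAll x f)
    have upd: "sat J (e(x := t)) f \<longleftrightarrow> sat I ((\<lambda>y. ev I (e y))(x := ev I t)) f" if "t \<in> D" for t
    proof -
      have "range (e(x := t)) \<subseteq> D" using that FAll.prems by auto
      moreover have "(\<lambda>y. ev I ((e(x := t)) y)) = (\<lambda>y. ev I (e y))(x := ev I t)" by auto
      ultimately show ?thesis using FAll.IH by metis
    qed
    have "(\<forall>d\<in>universe I. sat I ((\<lambda>y. ev I (e y))(x := d)) f) \<longleftrightarrow>
      (\<forall>t\<in>D. sat I ((\<lambda>y. ev I (e y))(x := ev I t)) f)" (is "?L \<longleftrightarrow> ?R")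
    proof
      assume R: ?R
      show ?L
      proof (rule ccontr)
        assume "\<not> ?L"
        then obtain t where "sat I ((\<lambda>y. ev I (e y))(x := ev I t)) (FNeg f)"
          using ex_ev_witness[OF wf, of "\<lambda>y. ev I (e y)" _ x "FNeg f"] by auto
        then show False using R evk[of "ev I t"] kD[of "ev I t"] by (metis rangeI sat.simps(4))
      qed
    next
      assume ?L
      then show ?R using ev_in_universe[OF wf] by blast
    qed
    then show ?case using upd by (simp add: J)
  qed simp_all
  have "true_in J f = true_in I f" if f: "sentence f" for f
  proof -
    define e :: "nat \<Rightarrow> ('p, 'r, 'c) elem" where "e = (\<lambda>_. k (con I undefined))"
    have e: "range e \<subseteq> D" using kD con by (auto simp: e_def)
    then have "true_in J f \<longleftrightarrow> sat I (\<lambda>x. ev I (e x)) f"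
      using true_in_sentence[OF f, of e J] main by (simp add: J)
    also have "\<dots> \<longleftrightarrow> true_in I f"
      using true_in_sentence[OF f, of "\<lambda>x. ev I (e x)" I] ev_in_universe[OF wf] by auto
    finally show ?thesis .
  qed
  then show ?thesis using wfJ by blast
qed

lemma entailsD:
  fixes I :: "('p, 'r, 'c, 'd) interp"
  assumes "entails \<Phi> f" "\<forall>g\<in>\<Phi>. sentence g" "sentence f" "model_of I \<Phi>"
  shows "true_in I f"
proof -
  obtain J :: "('p, 'r, 'c, ('p, 'r, 'c) elem) interp" where wf: "wf_interp J"
    and J: "\<And>f. sentence f \<Longrightarrow> true_in J f = true_in I f"
    using loewenheim_skolem[of I] assms(4) unfolding model_of_def by blast
  have "model_of J \<Phi>" using wf J assms(2,4) by (simp add: model_of_def)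
  then show ?thesis using assms(1,3) J by (auto simp: entails_def)
qed

lemma consistentI:
  fixes I :: "('p, 'r, 'c, 'd) interp"
  assumes "\<forall>g\<in>\<Phi>. sentence g" "model_of I \<Phi>"
  shows "consistent \<Phi>"
proof -
  obtain J :: "('p, 'r, 'c, ('p, 'r, 'c) elem) interp" where wf: "wf_interp J"
    and J: "\<And>f. sentence f \<Longrightarrow> true_in J f = true_in I f"
    using loewenheim_skolem[of I] assms(2) unfolding model_of_def by blast
  have "model_of J \<Phi>" using wf J assms by (simp add: model_of_def)
  then show ?thesis by (auto simp: consistent_def)
qed


section \<open>DL-Lite with role inclusions\<close>

datatype 'r role = Role 'r | Inv 'r

datatype ('p, 'r) concept = CName 'p | Exists "'r role"

datatype ('p, 'r) dl_axiom =
    ConceptIncl "('p, 'r) concept" "('p, 'r) concept"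
  | ConceptDisj "('p, 'r) concept" "('p, 'r) concept"
  | RoleIncl "'r role" "'r role"
  | RoleDisj "'r role" "'r role"

primrec role_fm :: "'r role \<Rightarrow> nat \<Rightarrow> nat \<Rightarrow> ('p, 'r, 'c) fm" where
  "role_fm (Role r) x y = FAtom (RAtom r (Var x) (Var y))"
| "role_fm (Inv r) x y = FAtom (RAtom r (Var y) (Var x))"

text \<open>The translation of a basic concept has the variable \<open>0\<close> free.\<close>

primrec concept_fm :: "('p, 'r) concept \<Rightarrow> ('p, 'r, 'c) fm" where
  "concept_fm (CName p) = FAtom (CAtom p (Var 0))"
| "concept_fm (Exists R) = FEx 1 (role_fm R 0 1)"

primrec axiom_fm :: "('p, 'r) dl_axiom \<Rightarrow> ('p, 'r, 'c) fm" where
  "axiom_fm (ConceptIncl C D) = FAll 0 (FImp (concept_fm C) (concept_fm D))"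
| "axiom_fm (ConceptDisj C D) = FAll 0 (FImp (concept_fm C) (FNeg (concept_fm D)))"
| "axiom_fm (RoleIncl R S) = FAll 0 (FAll 1 (FImp (role_fm R 0 1) (role_fm S 0 1)))"
| "axiom_fm (RoleDisj R S) = FAll 0 (FAll 1 (FImp (role_fm R 0 1) (FNeg (role_fm S 0 1))))"

definition dl_lite_R_tbox :: "('p, 'r, 'c) fm set \<Rightarrow> bool" where
  "dl_lite_R_tbox T \<longleftrightarrow> (\<exists>X. finite X \<and> T = axiom_fm ` X)"


section \<open>Conjunctive queries and epistemic dependencies\<close>

text \<open>\<open>CQ xs as\<close> is the conjunction of \<open>as\<close> with the variables \<open>xs\<close> existentially quantified.\<close>

datatype ('p, 'r, 'c) cq = CQBot | CQ "nat list" "('p, 'r, 'c) atom list"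

primrec conj_fm :: "('p, 'r, 'c) atom list \<Rightarrow> ('p, 'r, 'c) fm" where
  "conj_fm [] = FNeg FBot"
| "conj_fm (a # as) = FAnd (FAtom a) (conj_fm as)"

primrec cq_fm :: "('p, 'r, 'c) cq \<Rightarrow> ('p, 'r, 'c) fm" where
  "cq_fm CQBot = FBot"
| "cq_fm (CQ xs as) = foldr FEx xs (conj_fm as)"

primrec fv_cq :: "('p, 'r, 'c) cq \<Rightarrow> nat set" where
  "fv_cq CQBot = {}"
| "fv_cq (CQ xs as) = (\<Union>a\<in>set as. fv_atom a) - set xs"

lemma fv_cq_fm:
  fixes q :: "('p, 'r, 'c) cq"
  shows "fv (cq_fm q) = fv_cq q"
proof -
  have c: "fv (conj_fm as) = (\<Union>a\<in>set as. fv_atom a)" for as :: "('p, 'r, 'c) atom list"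
    by (induction as) auto
  have "fv (foldr FEx xs f) = fv f - set xs" for xs and f :: "('p, 'r, 'c) fm"
    by (induction xs) auto
  then show ?thesis using c by (cases q) auto
qed

type_synonym 'c subst = "nat \<Rightarrow> 'c option"

primrec subst_trm :: "'c subst \<Rightarrow> 'c trm \<Rightarrow> 'c trm" where
  "subst_trm \<sigma> (Var x) = (case \<sigma> x of None \<Rightarrow> Var x | Some c \<Rightarrow> Const c)"
| "subst_trm \<sigma> (Const c) = Const c"

primrec subst_atom :: "'c subst \<Rightarrow> ('p, 'r, 'c) atom \<Rightarrow> ('p, 'r, 'c) atom" where
  "subst_atom \<sigma> (CAtom p t) = CAtom p (subst_trm \<sigma> t)"
| "subst_atom \<sigma> (RAtom r t u) = RAtom r (subst_trm \<sigma> t) (subst_trm \<sigma> u)"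

primrec subst_cq :: "'c subst \<Rightarrow> ('p, 'r, 'c) cq \<Rightarrow> ('p, 'r, 'c) cq" where
  "subst_cq \<sigma> CQBot = CQBot"
| "subst_cq \<sigma> (CQ xs as) = CQ xs (map (subst_atom (\<sigma> |` (- set xs))) as)"

datatype ('p, 'r, 'c) ed = ED (body: "('p, 'r, 'c) cq") (head: "('p, 'r, 'c) cq")

definition subst_ed :: "'c subst \<Rightarrow> ('p, 'r, 'c) ed \<Rightarrow> ('p, 'r, 'c) ed" where
  "subst_ed \<sigma> \<tau> = ED (subst_cq \<sigma> (body \<tau>)) (subst_cq \<sigma> (head \<tau>))"

definition gs :: "('p, 'r, 'c) ed \<Rightarrow> 'c subst set" where
  "gs \<tau> = {\<sigma>. dom \<sigma> = fv_cq (body \<tau>) \<union> fv_cq (head \<tau>)}"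

definition linear_ed :: "('p, 'r, 'c) ed \<Rightarrow> bool" where
  "linear_ed \<tau> \<longleftrightarrow> (\<exists>xs a. body \<tau> = CQ xs [a])"

definition denial :: "('p, 'r, 'c) ed \<Rightarrow> bool" where
  "denial \<tau> \<longleftrightarrow> head \<tau> = CQBot"

definition satisfies_ed :: "('p, 'r, 'c) fm set \<Rightarrow> ('p, 'r, 'c) ed \<Rightarrow> bool" where
  "satisfies_ed \<Phi> \<tau> \<longleftrightarrow> (\<forall>\<sigma>\<in>gs \<tau>.
     entails \<Phi> (cq_fm (body (subst_ed \<sigma> \<tau>))) \<longrightarrow> entails \<Phi> (cq_fm (head (subst_ed \<sigma> \<tau>))))"

definition satisfies_policy :: "('p, 'r, 'c) fm set \<Rightarrow> ('p, 'r, 'c) ed set \<Rightarrow> bool" where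
  "satisfies_policy \<Phi> P \<longleftrightarrow> (\<forall>\<tau>\<in>P. satisfies_ed \<Phi> \<tau>)"


section \<open>Controlled query evaluation\<close>

definition ground :: "('p, 'r, 'c) atom \<Rightarrow> bool" where
  "ground a \<longleftrightarrow> fv_atom a = {}"

definition cl :: "('p, 'r, 'c) fm set \<Rightarrow> ('p, 'r, 'c) atom set \<Rightarrow> ('p, 'r, 'c) atom set" where
  "cl T A = {a. ground a \<and> entails (T \<union> FAtom ` A) (FAtom a)}"

record ('p, 'r, 'c) cqe =
  tbox :: "('p, 'r, 'c) fm set"
  policy :: "('p, 'r, 'c) ed set"
  abox :: "('p, 'r, 'c) atom set"

text \<open>
  The TBox is any set of first-order sentences (possibly with equality and constants), which
  covers every description logic with a first-order semantics.
\<close>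

definition cqe_instance :: "('p, 'r, 'c) cqe \<Rightarrow> bool" where
  "cqe_instance E \<longleftrightarrow> (\<forall>f\<in>tbox E. sentence f) \<and> finite (policy E) \<and> (\<forall>a\<in>abox E. ground a) \<and>
     consistent (tbox E \<union> FAtom ` abox E) \<and> finite (cl (tbox E) (abox E))"

abbreviation cl_of :: "('p, 'r, 'c) cqe \<Rightarrow> ('p, 'r, 'c) atom set" where
  "cl_of E \<equiv> cl (tbox E) (abox E)"

definition ga_censor :: "('p, 'r, 'c) cqe \<Rightarrow> ('p, 'r, 'c) atom set \<Rightarrow> bool" where
  "ga_censor E C \<longleftrightarrow> C \<subseteq> cl_of E \<and> satisfies_policy (tbox E \<union> FAtom ` C) (policy E)"

definition optimal_ga_censor :: "('p, 'r, 'c) cqe \<Rightarrow> ('p, 'r, 'c) atom set \<Rightarrow> bool" where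
  "optimal_ga_censor E C \<longleftrightarrow> ga_censor E C \<and> \<not> (\<exists>C'. C \<subset> C' \<and> ga_censor E C')"

text \<open>
  The intersection is taken within the closure, which only matters if there is no GA censor at
  all (the TBox alone may entail the body of a denial); it is then the whole closure.
\<close>

definition IGA_censor :: "('p, 'r, 'c) cqe \<Rightarrow> ('p, 'r, 'c) atom set" where
  "IGA_censor E = cl_of E \<inter> \<Inter> {C. optimal_ga_censor E C}"

definition violates ::
  "('p, 'r, 'c) cqe \<Rightarrow> ('p, 'r, 'c) atom set \<Rightarrow> ('p, 'r, 'c) atom set \<Rightarrow> bool" where
  "violates E A' A'' \<longleftrightarrow> (\<exists>\<tau>\<in>policy E. \<exists>\<sigma>\<in>gs \<tau>.
     entails (tbox E \<union> FAtom ` A'') (cq_fm (body (subst_ed \<sigma> \<tau>))) \<and>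
     \<not> entails (tbox E \<union> FAtom ` A') (cq_fm (head (subst_ed \<sigma> \<tau>))))"

definition is_MPV ::
  "('p, 'r, 'c) cqe \<Rightarrow> ('p, 'r, 'c) atom set \<Rightarrow> ('p, 'r, 'c) atom set \<Rightarrow> bool" where
  "is_MPV E A' A'' \<longleftrightarrow> A'' \<subseteq> cl_of E \<and> violates E A' A'' \<and> \<not> (\<exists>B. B \<subset> A'' \<and> violates E A' B)"

definition MPV0 :: "('p, 'r, 'c) cqe \<Rightarrow> ('p, 'r, 'c) atom set \<Rightarrow> ('p, 'r, 'c) atom set" where
  "MPV0 E A' = \<Union> {A''. is_MPV E A' A''}"

primrec MPV_iter :: "('p, 'r, 'c) cqe \<Rightarrow> nat \<Rightarrow> ('p, 'r, 'c) atom set" where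
  "MPV_iter E 0 = {}"
| "MPV_iter E (Suc i) = MPV0 E (cl_of E - MPV_iter E i)"

definition MPV :: "('p, 'r, 'c) cqe \<Rightarrow> ('p, 'r, 'c) atom set" where
  "MPV E = MPV_iter E (card (cl_of E))"

definition MPV_censor :: "('p, 'r, 'c) cqe \<Rightarrow> ('p, 'r, 'c) atom set" where
  "MPV_censor E = cl_of E - MPV E"

end

theory Submission
  imports Defs
begin

text \<open>
  For denials, heads are never entailed below the closure, so violation is a fixed upward closed
  property of sets of facts, the iteration is constant after one step, and a fact lies in all
  maximal nonviolating sets iff it lies in no minimal violating one.

  For a DL-Lite TBox, a single-atom query entailed by a consistent \<open>T \<union> A\<close> is entailed by \<open>T\<close> and a single
  fact of \<open>A\<close>. Hence MPVs are singletons, and the complements of the iterates descend to the greatest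
  GA censor, which is the only optimal one.

  The single-fact property needs no chase. Given countermodels \<open>I\<^sub>\<alpha>\<close> of the query for each \<open>\<alpha> \<in> A\<close>
  and a model \<open>J\<close> of \<open>T \<union> A\<close>, take the product of all universes and let an atom hold iff it holds in
  the \<open>J\<close>-component and in some \<open>\<alpha>\<close>-component. Positive inclusions survive because their left-hand
  sides are single atoms, negative ones because they hold in \<open>J\<close>.
\<close>

section \<open>Monotonicity of entailment and violation\<close>

lemma entails_mono: "entails \<Phi> f \<Longrightarrow> \<Phi> \<subseteq> \<Psi> \<Longrightarrow> entails \<Psi> f"
  unfolding entails_def model_of_def by blast

lemma consistent_not_entails_FBot:
  assumes "consistent \<Phi>"
  shows "\<not> entails \<Phi> FBot"
proof -
  obtain I :: "('a, 'b, 'c, ('a, 'b, 'c) elem) interp" where I: "model_of I \<Phi>"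
    using assms unfolding consistent_def by blast
  then obtain d where "d \<in> universe I" unfolding model_of_def wf_interp_def by blast
  then have "\<not> true_in I FBot" unfolding true_in_def by (auto intro: exI[of _ "\<lambda>_. d"])
  then show ?thesis using I unfolding entails_def by blast
qed

text \<open>A model of the TBox and the ABox satisfies all facts they entail, so one model serves
  every \<open>C\<close>.\<close>

lemma cqe_consistent_subset_cl:
  assumes "cqe_instance E" "C \<subseteq> cl_of E"
  shows "consistent (tbox E \<union> FAtom ` C)"
proof -
  obtain I :: "('a, 'b, 'c, ('a, 'b, 'c) elem) interp"
    where I: "model_of I (tbox E \<union> FAtom ` abox E)"
    using assms(1) unfolding cqe_instance_def consistent_def by blast
  then have "model_of I (tbox E \<union> FAtom ` C)"
    using assms(2) unfolding cl_def entails_def model_of_def by blast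
  then show ?thesis unfolding consistent_def by blast
qed

text \<open>The first set occurs only in the negated entailment of a head, the second only in the
  entailment of a body; hence the opposite directions.\<close>

lemma violates_mono: "violates E A B \<Longrightarrow> A' \<subseteq> A \<Longrightarrow> B \<subseteq> B' \<Longrightarrow> violates E A' B'"
  unfolding violates_def
  by (meson entails_mono image_mono subset_refl Un_mono)

text \<open>Failing the policy is violating it against oneself, so censors and MPVs can be compared
  through \<open>violates_mono\<close>.\<close>

lemma ga_censor_iff: "ga_censor E C \<longleftrightarrow> C \<subseteq> cl_of E \<and> \<not> violates E C C"
  unfolding ga_censor_def satisfies_policy_def satisfies_ed_def violates_def by blast

lemma MPV_iter_subset_cl: "MPV_iter E i \<subseteq> cl_of E"
  by (cases i) (auto simp: MPV0_def is_MPV_def)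

section \<open>Denials\<close>

lemma ex_minimal_subset:
  assumes "finite B" "V B"
  shows "\<exists>m\<subseteq>B. V m \<and> \<not> (\<exists>D. D \<subset> m \<and> V D)"
  using assms
proof (induction B rule: finite_psubset_induct)
  case (psubset B)
  show ?case
  proof (cases "\<exists>D. D \<subset> B \<and> V D")
    case True
    then show ?thesis using psubset.IH by (meson order.strict_implies_order order.trans)
  qed (use psubset.prems in blast)
qed

text \<open>If \<open>x\<close> lies in a minimal violating \<open>m\<close>, then
  \<open>m - {x}\<close> extends to a maximal nonviolating set, which must omit \<open>x\<close>.
  Conversely, a maximal nonviolating \<open>C\<close> without \<open>x\<close> becomes violating
  when \<open>x\<close> is added, and a minimal violating subset of \<open>insert x C\<close> has to
  contain \<open>x\<close>. If even \<open>{}\<close> violates, both sides are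
  \<open>S\<close>.\<close>

lemma Inter_maximal_eq_Diff_Union_minimal:
  assumes fin: "finite S"
    and up: "\<And>B D. V B \<Longrightarrow> B \<subseteq> D \<Longrightarrow> V D"
  shows "S \<inter> \<Inter> {C. (C \<subseteq> S \<and> \<not> V C) \<and> \<not> (\<exists>C'. C \<subset> C' \<and> C' \<subseteq> S \<and> \<not> V C')} =
    S - \<Union> {m. m \<subseteq> S \<and> V m \<and> \<not> (\<exists>D. D \<subset> m \<and> V D)}" (is "S \<inter> \<Inter> ?Max = S - \<Union> ?Min")
proof (intro equalityI subsetI)
  fix x assume x: "x \<in> S \<inter> \<Inter> ?Max"
  have False if m: "m \<in> ?Min" and xm: "x \<in> m" for m
  proof -
    let ?F = "{C. C \<subseteq> S \<and> \<not> V C}"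
    have "m - {x} \<in> ?F" using m xm by blast
    moreover have "finite ?F" using fin by simp
    ultimately obtain C where C: "C \<in> ?F" "m - {x} \<subseteq> C"
      and max: "\<forall>C'\<in>?F. C \<subseteq> C' \<longrightarrow> C = C'"
      using finite_has_maximal2[of ?F "m - {x}"] by metis
    have "C \<in> ?Max" using C(1) max by blast
    then have "x \<in> C" using x by blast
    then have "V C" using C(2) m up[of m C] by blast
    then show False using C(1) by blast
  qed
  then show "x \<in> S - \<Union> ?Min" using x by blast
next
  fix x assume x: "x \<in> S - \<Union> ?Min"
  have "x \<in> C" if C: "C \<in> ?Max" for C
  proof (rule ccontr)
    assume xC: "x \<notin> C"
    then have "C \<subset> insert x C" "insert x C \<subseteq> S" using C x by auto
    then have "V (insert x C)" using C by blast
    then obtain m where m: "m \<subseteq> insert x C" "V m" "\<not> (\<exists>D. D \<subset> m \<and> V D)"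
      using ex_minimal_subset[OF finite_subset[OF \<open>insert x C \<subseteq> S\<close> fin]] by metis
    then have "m \<in> ?Min" using \<open>insert x C \<subseteq> S\<close> by blast
    then have "m \<subseteq> C" using x m(1) by blast
    then show False using up[OF m(2)] C by blast
  qed
  then show "x \<in> S \<inter> \<Inter> ?Max" using x by blast
qed

text \<open>The value \<open>{}\<close> is a canonical first argument: \<open>violates E {}\<close>
  is a property of one set, upward closed as \<open>Inter_maximal_eq_Diff_Union_minimal\<close>
  requires.\<close>

lemma violates_denial:
  assumes E: "cqe_instance E" and den: "\<forall>\<tau>\<in>policy E. denial \<tau>" and A: "A \<subseteq> cl_of E"
  shows "violates E A B \<longleftrightarrow> violates E {} B"
proof -
  have "cq_fm (head (subst_ed \<sigma> \<tau>)) = FBot" if "\<tau> \<in> policy E" for \<sigma> \<tau>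
    using den that by (simp add: denial_def subst_ed_def)
  moreover have "\<not> entails (tbox E \<union> FAtom ` C) FBot" if "C \<subseteq> cl_of E" for C
    using consistent_not_entails_FBot[OF cqe_consistent_subset_cl[OF E that]] .
  ultimately show ?thesis unfolding violates_def using A by (metis empty_subsetI)
qed

theorem MPV_censor_eq_IGA_censor_denials:
  assumes E: "cqe_instance E" and den: "\<forall>\<tau>\<in>policy E. denial \<tau>"
  shows "MPV_censor E = IGA_censor E"
proof (cases "cl_of E = {}")
  case True
  then show ?thesis by (simp add: MPV_censor_def IGA_censor_def)
next
  case False
  have fin: "finite (cl_of E)" using E by (simp add: cqe_instance_def)
  \<comment> \<open>A nonempty closure gives the iteration at least one step, and its last step
    yields the result whatever the previous iterate was.\<close>
  then obtain n where n: "card (cl_of E) = Suc n"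
    using False by (metis card_eq_0_iff not0_implies_Suc)
  let ?V = "violates E {}"
  have MPV: "MPV E = \<Union> {m. m \<subseteq> cl_of E \<and> ?V m \<and> \<not> (\<exists>D. D \<subset> m \<and> ?V D)}"
    unfolding MPV_def n MPV_iter.simps MPV0_def is_MPV_def
    using violates_denial[OF E den, of "cl_of E - MPV_iter E n"] by simp
  have ga: "ga_censor E C \<longleftrightarrow> C \<subseteq> cl_of E \<and> \<not> ?V C" for C
    using violates_denial[OF E den, of C C] unfolding ga_censor_iff by blast
  show ?thesis
    unfolding MPV_censor_def MPV IGA_censor_def optimal_ga_censor_def ga
    by (rule Inter_maximal_eq_Diff_Union_minimal[symmetric, OF fin]) (rule violates_mono, auto)
qed

section \<open>Atomic queries over DL-Lite TBoxes\<close>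

primrec role_holds :: "('p, 'r, 'c, 'd) interp \<Rightarrow> 'r role \<Rightarrow> 'd \<Rightarrow> 'd \<Rightarrow> bool" where
  "role_holds I (Role r) d d' \<longleftrightarrow> (d, d') \<in> rext I r"
| "role_holds I (Inv r) d d' \<longleftrightarrow> (d', d) \<in> rext I r"

primrec concept_holds :: "('p, 'r, 'c, 'd) interp \<Rightarrow> ('p, 'r) concept \<Rightarrow> 'd \<Rightarrow> bool" where
  "concept_holds I (CName p) d \<longleftrightarrow> d \<in> cext I p"
| "concept_holds I (Exists R) d \<longleftrightarrow> (\<exists>d'\<in>universe I. role_holds I R d d')"

primrec axiom_holds :: "('p, 'r, 'c, 'd) interp \<Rightarrow> ('p, 'r) dl_axiom \<Rightarrow> bool" where
  "axiom_holds I (ConceptIncl C D) \<longleftrightarrow>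
     (\<forall>d\<in>universe I. concept_holds I C d \<longrightarrow> concept_holds I D d)"
| "axiom_holds I (ConceptDisj C D) \<longleftrightarrow>
     (\<forall>d\<in>universe I. concept_holds I C d \<longrightarrow> \<not> concept_holds I D d)"
| "axiom_holds I (RoleIncl R S) \<longleftrightarrow>
     (\<forall>d\<in>universe I. \<forall>d'\<in>universe I. role_holds I R d d' \<longrightarrow> role_holds I S d d')"
| "axiom_holds I (RoleDisj R S) \<longleftrightarrow>
     (\<forall>d\<in>universe I. \<forall>d'\<in>universe I. role_holds I R d d' \<longrightarrow> \<not> role_holds I S d d')"

lemma sat_role_fm: "sat I e (role_fm R x y) \<longleftrightarrow> role_holds I R (e x) (e y)"
  by (cases R) auto

lemma sat_concept_fm: "sat I e (concept_fm C) \<longleftrightarrow> concept_holds I C (e 0)"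
  by (cases C) (auto simp: sat_role_fm)

lemma true_in_axiom_fm:
  assumes "wf_interp I"
  shows "true_in I (axiom_fm ax) \<longleftrightarrow> axiom_holds I ax"
proof -
  have sat: "sat I e (axiom_fm ax) \<longleftrightarrow> axiom_holds I ax" for e
    by (cases ax) (simp_all add: sat_role_fm sat_concept_fm)
  obtain d where "d \<in> universe I" using assms unfolding wf_interp_def by blast
  then have "\<exists>e :: nat \<Rightarrow> _. range e \<subseteq> universe I" by (intro exI[of _ "\<lambda>_. d"]) auto
  then show ?thesis unfolding true_in_def sat by blast
qed

section \<open>Product interpretations\<close>

text \<open>The second component ranges over functions on the whole index type, so \<open>A\<close>
  restricts only the disjunctions. The conjunct for \<open>J\<close> is there for the disjointness
  axioms, whose two sides could otherwise hold together at different indices.\<close>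

definition glue ::
  "('p, 'r, 'c, 'd) interp \<Rightarrow> ('i \<Rightarrow> ('p, 'r, 'c, 'e) interp) \<Rightarrow> 'i set \<Rightarrow>
    ('p, 'r, 'c, 'd \<times> ('i \<Rightarrow> 'e)) interp" where
  "glue J I A = (let U = {(j, f). j \<in> universe J \<and> (\<forall>i. f i \<in> universe (I i))} in
    \<lparr>universe = U,
     con = (\<lambda>c. (con J c, \<lambda>i. con (I i) c)),
     cext = (\<lambda>p. {d \<in> U. fst d \<in> cext J p \<and> (\<exists>i\<in>A. snd d i \<in> cext (I i) p)}),
     rext = (\<lambda>r. {(d, d') \<in> U \<times> U. (fst d, fst d') \<in> rext J r \<and>
        (\<exists>i\<in>A. (snd d i, snd d' i) \<in> rext (I i) r)})\<rparr>)"

lemma glue_universe: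
  "universe (glue J I A) = {(j, f). j \<in> universe J \<and> (\<forall>i. f i \<in> universe (I i))}"
  by (simp add: glue_def Let_def)

lemma glue_sel:
  "con (glue J I A) c = (con J c, \<lambda>i. con (I i) c)"
  "cext (glue J I A) p =
     {d \<in> universe (glue J I A). fst d \<in> cext J p \<and> (\<exists>i\<in>A. snd d i \<in> cext (I i) p)}"
  "rext (glue J I A) r = {(d, d') \<in> universe (glue J I A) \<times> universe (glue J I A).
     (fst d, fst d') \<in> rext J r \<and> (\<exists>i\<in>A. (snd d i, snd d' i) \<in> rext (I i) r)}"
  by (simp_all add: glue_def Let_def)

lemma wf_glue:
  assumes "wf_interp J" "\<And>i. wf_interp (I i)"
  shows "wf_interp (glue J I A)"
proof -
  have "con (glue J I A) c \<in> universe (glue J I A)" for c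
    using assms by (auto simp: glue_universe glue_sel(1) wf_interp_def)
  then show ?thesis unfolding wf_interp_def by (auto simp: glue_sel(2,3))
qed

lemma glue_role_holds:
  assumes "d \<in> universe (glue J I A)" "d' \<in> universe (glue J I A)"
  shows "role_holds (glue J I A) R d d' \<longleftrightarrow>
    role_holds J R (fst d) (fst d') \<and> (\<exists>i\<in>A. role_holds (I i) R (snd d i) (snd d' i))"
  using assms by (cases R) (auto simp: glue_sel(3))

text \<open>In a product, the successors in \<open>J\<close> and in a factor \<open>I i\<close> can
  be chosen independently, so the conjunction and the disjunction both pass through
  \<open>Exists\<close>.\<close>

lemma glue_concept_holds:
  assumes d: "d \<in> universe (glue J I A)"
  shows "concept_holds (glue J I A) C d \<longleftrightarrow>
    concept_holds J C (fst d) \<and> (\<exists>i\<in>A. concept_holds (I i) C (snd d i))"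
proof (cases C)
  case (CName p)
  then show ?thesis using d by (auto simp: glue_sel(2))
next
  case (Exists R)
  show ?thesis
  proof
    assume "concept_holds (glue J I A) C d"
    then show "concept_holds J C (fst d) \<and> (\<exists>i\<in>A. concept_holds (I i) C (snd d i))"
      using Exists glue_role_holds[OF d, of _ R] by (fastforce simp: glue_universe)
  next
    assume "concept_holds J C (fst d) \<and> (\<exists>i\<in>A. concept_holds (I i) C (snd d i))"
    then obtain j i e where j: "j \<in> universe J" "role_holds J R (fst d) j"
      and e: "i \<in> A" "e \<in> universe (I i)" "role_holds (I i) R (snd d i) e"
      using Exists by auto
    \<comment> \<open>Only coordinate \<open>i\<close> needs a successor; the others keep the values
      of \<open>d\<close>.\<close>
    have "(j, (snd d)(i := e)) \<in> universe (glue J I A)"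
      using d j(1) e(2) by (auto simp: glue_universe)
    moreover from this have "role_holds (glue J I A) R d (j, (snd d)(i := e))"
      using glue_role_holds[OF d, of "(j, (snd d)(i := e))" R] j(2) e by auto
    ultimately show "concept_holds (glue J I A) C d" using Exists by auto
  qed
qed

text \<open>For an inclusion, the index witnessing the left side also witnesses the right side.
  Disjointness is inherited from \<open>J\<close> alone.\<close>

lemma glue_axiom_holds:
  assumes "axiom_holds J ax" "\<And>i. axiom_holds (I i) ax"
  shows "axiom_holds (glue J I A) ax"
proof -
  have U: "fst d \<in> universe J" "snd d i \<in> universe (I i)" if "d \<in> universe (glue J I A)" for d i
    using that by (auto simp: glue_universe)
  show ?thesis
  proof (cases ax)
    case (ConceptIncl C D)
    then show ?thesis using assms by (simp add: glue_concept_holds) (blast intro: U)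
  next
    case (ConceptDisj C D)
    then show ?thesis using assms by (simp add: glue_concept_holds) (blast intro: U)
  next
    case (RoleIncl R S)
    then show ?thesis using assms by (simp add: glue_role_holds) (blast intro: U)
  next
    case (RoleDisj R S)
    then show ?thesis using assms by (simp add: glue_role_holds) (blast intro: U)
  qed
qed

lemma glue_val:
  "fst (val (glue J I A) e t) = val J (\<lambda>x. fst (e x)) t"
  "snd (val (glue J I A) e t) i = val (I i) (\<lambda>x. snd (e x) i) t"
  by (cases t; simp add: glue_sel(1))+

lemma val_in_universe: "wf_interp I \<Longrightarrow> range e \<subseteq> universe I \<Longrightarrow> val I e t \<in> universe I"
  by (cases t) (auto simp: wf_interp_def)

lemma glue_sat_atom:
  assumes "wf_interp (glue J I A)" "range e \<subseteq> universe (glue J I A)"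
  shows "sat_atom (glue J I A) e a \<longleftrightarrow>
    sat_atom J (\<lambda>x. fst (e x)) a \<and> (\<exists>i\<in>A. sat_atom (I i) (\<lambda>x. snd (e x) i) a)"
  using val_in_universe[OF assms]
  by (cases a) (auto simp: glue_sel(2,3) glue_val)

text \<open>The index comes from the atom, and the query witnesses are projected to it. Several
  atoms could hold at different indices.\<close>

lemma glue_sat_atomic_query:
  assumes "wf_interp (glue J I A)" "range e \<subseteq> universe (glue J I A)"
    "sat (glue J I A) e (cq_fm (CQ xs [a]))"
  shows "\<exists>i\<in>A. sat (I i) (\<lambda>x. snd (e x) i) (cq_fm (CQ xs [a]))"
  using assms(2,3)
proof (induction xs arbitrary: e)
  case Nil
  then show ?case using glue_sat_atom[OF assms(1)] by simp
next
  case (Cons x xs)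
  then obtain d where d: "d \<in> universe (glue J I A)"
    "sat (glue J I A) (e(x := d)) (cq_fm (CQ xs [a]))" by auto
  have "range (e(x := d)) \<subseteq> universe (glue J I A)" using Cons.prems(1) d(1) by auto
  from Cons.IH[OF this d(2)] obtain i where
    i: "i \<in> A" "sat (I i) (\<lambda>y. snd ((e(x := d)) y) i) (cq_fm (CQ xs [a]))" by blast
  have "(\<lambda>y. snd ((e(x := d)) y) i) = (\<lambda>y. snd (e y) i)(x := snd d i)" by auto
  moreover have "snd d i \<in> universe (I i)" using d(1) by (auto simp: glue_universe)
  ultimately show ?case using i by auto
qed

text \<open>The facts index the factors, and consistency supplies the factor \<open>J\<close>. For
  \<open>A = {}\<close> the claim means that the TBox alone entails no such query.\<close>

lemma dl_lite_R_atomic_query_single_fact: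
  assumes T: "dl_lite_R_tbox T" and sentT: "\<forall>f\<in>T. sentence f"
    and ground: "\<forall>\<alpha>\<in>A. ground \<alpha>" and cons: "consistent (T \<union> FAtom ` A)"
    and sentq: "sentence (cq_fm (CQ xs [a]))"
    and ent: "entails (T \<union> FAtom ` A) (cq_fm (CQ xs [a]))"
  shows "\<exists>\<alpha>\<in>A. entails (T \<union> FAtom ` {\<alpha>}) (cq_fm (CQ xs [a]))"
proof (rule ccontr)
  let ?q = "cq_fm (CQ xs [a])"
  assume "\<not> ?thesis"
  then have neg: "\<forall>\<alpha>\<in>A. \<exists>I :: ('a, 'b, 'c, ('a, 'b, 'c) elem) interp.
      model_of I (T \<union> {FAtom \<alpha>}) \<and> \<not> true_in I ?q"
    unfolding entails_def by simp
  obtain J :: "('a, 'b, 'c, ('a, 'b, 'c) elem) interp" where J: "model_of J (T \<union> FAtom ` A)"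
    using cons unfolding consistent_def by blast
  \<comment> \<open>The product runs over all indices, so those outside \<open>A\<close> also need a
    model of \<open>T\<close>; \<open>J\<close> serves for them.\<close>
  have "\<forall>\<alpha>. \<exists>I :: ('a, 'b, 'c, ('a, 'b, 'c) elem) interp.
      model_of I T \<and> (\<alpha> \<in> A \<longrightarrow> true_in I (FAtom \<alpha>) \<and> \<not> true_in I ?q)"
    using neg J unfolding model_of_def by (metis Un_iff insertI1)
  then obtain I :: "_ \<Rightarrow> ('a, 'b, 'c, ('a, 'b, 'c) elem) interp" where
    I: "\<And>\<alpha>. model_of (I \<alpha>) T" "\<And>\<alpha>. \<alpha> \<in> A \<Longrightarrow> true_in (I \<alpha>) (FAtom \<alpha>)"
    "\<And>\<alpha>. \<alpha> \<in> A \<Longrightarrow> \<not> true_in (I \<alpha>) ?q"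
    by metis
  define M where "M = glue J I A"
  have wfJ: "wf_interp J" and wfI: "wf_interp (I \<alpha>)" for \<alpha>
    using J I(1) by (auto simp: model_of_def)
  then have wf: "wf_interp M" by (simp add: M_def wf_glue)
  have proj: "range (\<lambda>x. fst (e x)) \<subseteq> universe J" "range (\<lambda>x. snd (e x) \<alpha>) \<subseteq> universe (I \<alpha>)"
    if "range e \<subseteq> universe M" for e :: "nat \<Rightarrow> _" and \<alpha>
  proof -
    have "e x \<in> universe M" for x using that by blast
    then have "fst (e x) \<in> universe J \<and> snd (e x) \<alpha> \<in> universe (I \<alpha>)" for x
      by (metis (mono_tags, lifting) M_def case_prod_unfold glue_universe mem_Collect_eq)
    then show "range (\<lambda>x. fst (e x)) \<subseteq> universe J" "range (\<lambda>x. snd (e x) \<alpha>) \<subseteq> universe (I \<alpha>)"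
      by auto
  qed
  obtain X where X: "T = axiom_fm ` X" using T unfolding dl_lite_R_tbox_def by blast
  have "true_in M f" if f: "f \<in> T" for f
  proof -
    obtain ax where ax: "f = axiom_fm ax" using f X by blast
    have "true_in J f" "true_in (I \<alpha>) f" for \<alpha> using J I(1) f by (auto simp: model_of_def)
    then show ?thesis
      using glue_axiom_holds[of J ax I A] wf wfJ wfI by (simp add: ax true_in_axiom_fm M_def)
  qed
  \<comment> \<open>Index \<open>\<alpha>\<close> itself witnesses the disjunction, since
    \<open>I \<alpha>\<close> satisfies the fact \<open>\<alpha>\<close>.\<close>
  moreover have "true_in M (FAtom \<alpha>)" if \<alpha>: "\<alpha> \<in> A" for \<alpha>
  proof -
    have "true_in J (FAtom \<alpha>)" using J \<alpha> by (auto simp: model_of_def)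
    then show ?thesis
      using I(2)[OF \<alpha>] \<alpha> proj glue_sat_atom[of J I A] wf unfolding true_in_def M_def
      by (metis sat.simps(2))
  qed
  ultimately have "model_of M (T \<union> FAtom ` A)" using wf by (auto simp: model_of_def)
  \<comment> \<open>\<open>M\<close> lives on a product type rather than on \<open>elem\<close>;
    \<open>entailsD\<close> carries the entailment over, but only for sentences.\<close>
  moreover have "\<forall>g\<in>T \<union> FAtom ` A. sentence g"
    using sentT ground by (auto simp: sentence_def ground_def)
  ultimately have "true_in M ?q" using entailsD[OF ent _ sentq] by blast
  moreover obtain d where "d \<in> universe M" using wf unfolding wf_interp_def by blast
  then have e: "range (\<lambda>_ :: nat. d) \<subseteq> universe M" by auto
  ultimately have "sat M (\<lambda>_. d) ?q" unfolding true_in_def by blast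
  then obtain \<alpha> where "\<alpha> \<in> A" "sat (I \<alpha>) (\<lambda>_. snd d \<alpha>) ?q"
    using glue_sat_atomic_query[of J I A "\<lambda>_. d"] wf e unfolding M_def by blast
  then show False using I(3) true_in_sentence[OF sentq proj(2)[OF e]] by blast
qed

section \<open>Linear policies\<close>

lemma fv_subst_trm: "fv_trm (subst_trm \<sigma> t) = fv_trm t - dom \<sigma>"
  by (cases t) (auto split: option.splits)

lemma fv_subst_atom: "fv_atom (subst_atom \<sigma> a) = fv_atom a - dom \<sigma>"
  by (cases a) (auto simp: fv_subst_trm)

lemma fv_subst_cq: "fv_cq (subst_cq \<sigma> q) = fv_cq q - dom \<sigma>"
  by (cases q) (auto simp: fv_subst_atom)

text \<open>A ground substitution makes a linear body a closed single-atom query, so one fact of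
  \<open>B\<close> suffices to entail it; the head condition concerns only \<open>A\<close> and
  carries over.\<close>

lemma violates_single_fact:
  assumes E: "cqe_instance E" and T: "dl_lite_R_tbox (tbox E)"
    and lin: "\<forall>\<tau>\<in>policy E. linear_ed \<tau>"
    and B: "B \<subseteq> cl_of E" and viol: "violates E A B"
  shows "\<exists>\<alpha>\<in>B. violates E A {\<alpha>}"
proof -
  obtain \<tau> \<sigma> where \<tau>: "\<tau> \<in> policy E" and \<sigma>: "\<sigma> \<in> gs \<tau>"
    and ent: "entails (tbox E \<union> FAtom ` B) (cq_fm (body (subst_ed \<sigma> \<tau>)))"
    and nent: "\<not> entails (tbox E \<union> FAtom ` A) (cq_fm (head (subst_ed \<sigma> \<tau>)))"
    using viol unfolding violates_def by blast
  obtain xs a where "body \<tau> = CQ xs [a]" using lin \<tau> unfolding linear_ed_def by blast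
  then obtain b where b: "body (subst_ed \<sigma> \<tau>) = CQ xs [b]" by (simp add: subst_ed_def)
  have "fv_cq (body (subst_ed \<sigma> \<tau>)) = {}"
    using \<sigma> by (auto simp: gs_def subst_ed_def fv_subst_cq)
  then have sent: "sentence (cq_fm (CQ xs [b]))"
    unfolding sentence_def fv_cq_fm b .
  have "\<forall>f\<in>tbox E. sentence f" using E by (simp add: cqe_instance_def)
  moreover have "\<forall>\<alpha>\<in>B. ground \<alpha>" using B by (auto simp: cl_def)
  ultimately obtain \<alpha> where "\<alpha> \<in> B" "entails (tbox E \<union> FAtom ` {\<alpha>}) (cq_fm (CQ xs [b]))"
    using dl_lite_R_atomic_query_single_fact[OF T _ _ cqe_consistent_subset_cl[OF E B] sent]
      ent[unfolded b] by blast
  then show ?thesis using \<tau> \<sigma> nent b unfolding violates_def by metis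
qed

lemma MPV0_eq:
  assumes "\<And>A B. B \<subseteq> cl_of E \<Longrightarrow> violates E A B \<Longrightarrow> \<exists>\<alpha>\<in>B. violates E A {\<alpha>}"
  shows "MPV0 E A = {\<alpha> \<in> cl_of E. violates E A {\<alpha>}}"
proof -
  have "is_MPV E A B \<longleftrightarrow> (\<exists>\<alpha>\<in>cl_of E. B = {\<alpha>} \<and> violates E A {\<alpha>})" for B
  proof
    assume mpv: "is_MPV E A B"
    then obtain \<alpha> where \<alpha>: "\<alpha> \<in> B" "violates E A {\<alpha>}"
      using assms[of B A] unfolding is_MPV_def by blast
    moreover have "B = {\<alpha>}" using mpv \<alpha> unfolding is_MPV_def by blast
    ultimately show "\<exists>\<alpha>\<in>cl_of E. B = {\<alpha>} \<and> violates E A {\<alpha>}"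
      using mpv unfolding is_MPV_def by blast
  next
    assume "\<exists>\<alpha>\<in>cl_of E. B = {\<alpha>} \<and> violates E A {\<alpha>}"
    \<comment> \<open>The case \<open>B = {}\<close> of the assumption excludes a violation by the
      TBox alone, which makes violating singletons minimal.\<close>
    moreover have "\<not> violates E A {}" using assms[of "{}" A] by auto
    ultimately show "is_MPV E A B"
      unfolding is_MPV_def by (auto simp: psubset_eq subset_singleton_iff)
  qed
  then show ?thesis unfolding MPV0_def by auto
qed

theorem MPV_censor_eq_IGA_censor_linear:
  assumes E: "cqe_instance E" and T: "dl_lite_R_tbox (tbox E)"
    and lin: "\<forall>\<tau>\<in>policy E. linear_ed \<tau>"
  shows "MPV_censor E = IGA_censor E"
proof -
  note single = violates_single_fact[OF E T lin]
  have MPV0: "MPV0 E A = {\<alpha> \<in> cl_of E. violates E A {\<alpha>}}" for A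
    by (rule MPV0_eq) (rule single)
  have fin: "finite (cl_of E)" using E by (simp add: cqe_instance_def)
  have mono0: "MPV0 E A \<subseteq> MPV0 E A'" if "A' \<subseteq> A" for A A'
    unfolding MPV0 using violates_mono[OF _ that] by auto
  \<comment> \<open>Two order reversals, by the complement and by \<open>MPV0\<close>, make the
    iteration increasing.\<close>
  have "MPV_iter E i \<subseteq> MPV_iter E (Suc i)" for i
    by (induction i) (simp, subst (1 2) MPV_iter.simps(2), rule mono0, blast)
  then have mono: "mono (MPV_iter E)" by (intro mono_iff_le_Suc[THEN iffD2] allI)
  \<comment> \<open>Each iterate determines the next, so the chain is strict until it stops for
    good; every strict step adds a fact, hence \<open>card (cl_of E)\<close> steps suffice.\<close>
  have "finite (range (MPV_iter E))"
    by (rule finite_subset[of _ "Pow (cl_of E)"]) (use MPV_iter_subset_cl fin in auto)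
  then have "\<exists>N. (\<forall>n\<le>N. \<forall>m\<le>N. m < n \<longrightarrow> MPV_iter E m < MPV_iter E n) \<and>
      (\<forall>n\<ge>N. MPV_iter E N = MPV_iter E n)"
    by (rule finite_mono_remains_stable_implies_strict_prefix[OF _ mono]) auto
  then have "MPV E = (\<Union>n. MPV_iter E n)"
    unfolding MPV_def
    by (rule finite_mono_strict_prefix_implies_finite_fixpoint[OF MPV_iter_subset_cl fin])
  \<comment> \<open>One more step adds nothing: every fact that violates the policy against the MPV
    censor is already removed.\<close>
  then have "MPV_iter E (Suc (card (cl_of E))) \<subseteq> MPV E" by blast
  then have fix_: "MPV0 E (MPV_censor E) \<subseteq> MPV E" by (simp add: MPV_censor_def MPV_def)
  have "\<not> violates E (MPV_censor E) (MPV_censor E)"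
  proof
    assume "violates E (MPV_censor E) (MPV_censor E)"
    then obtain \<alpha> where "\<alpha> \<in> MPV_censor E" "violates E (MPV_censor E) {\<alpha>}"
      using single[of "MPV_censor E"] by (auto simp: MPV_censor_def)
    then have "\<alpha> \<in> MPV0 E (MPV_censor E)" unfolding MPV0 by (simp add: MPV_censor_def)
    then show False using fix_ \<open>\<alpha> \<in> MPV_censor E\<close> by (auto simp: MPV_censor_def)
  qed
  then have ga: "ga_censor E (MPV_censor E)" by (auto simp: ga_censor_iff MPV_censor_def)
  have greatest: "C \<subseteq> MPV_censor E" if C: "ga_censor E C" for C
  proof -
    have "C \<inter> MPV_iter E i = {}" for i
    proof (induction i)
      case (Suc i)
      then have "C \<subseteq> cl_of E - MPV_iter E i" using C by (auto simp: ga_censor_iff)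
      \<comment> \<open>A fact of \<open>C\<close> violating against this superset of
        \<open>C\<close> would, by \<open>violates_mono\<close>, make \<open>C\<close> violate
        against itself.\<close>
      then have "\<not> violates E (cl_of E - MPV_iter E i) {\<alpha>}" if "\<alpha> \<in> C" for \<alpha>
        using violates_mono[of E _ "{\<alpha>}" C C] C that by (auto simp: ga_censor_iff)
      then show ?case by (auto simp: MPV0)
    qed simp
    then show ?thesis using C by (auto simp: MPV_censor_def MPV_def ga_censor_iff)
  qed
  have "optimal_ga_censor E C \<longleftrightarrow> C = MPV_censor E" for C
    unfolding optimal_ga_censor_def using ga greatest by blast
  then show ?thesis by (auto simp: IGA_censor_def MPV_censor_def)
qed

theorem theorem5:
  fixes E :: "('p, 'r, 'c :: {countable, infinite}) cqe"
  assumes "cqe_instance E"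
  shows "((\<forall>\<tau>\<in>policy E. denial \<tau>) \<longrightarrow> MPV_censor E = IGA_censor E) \<and>
         (dl_lite_R_tbox (tbox E) \<and> (\<forall>\<tau>\<in>policy E. linear_ed \<tau>) \<longrightarrow> MPV_censor E = IGA_censor E)"
  using MPV_censor_eq_IGA_censor_denials[OF assms] MPV_censor_eq_IGA_censor_linear[OF assms]
  by blast

end
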